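(* The inequality $$\bigg\|\sum_{I\in\mathcal D:\,|I|\ge2^{-n}}\alpha_I h_I\bigg\|_\infty\ \gtrsim\ \sum_{I\in\mathcal D:\,|I|\ge2^{-n}}|\alpha_I|\cdot|I|$$ does not hold in general. That is, there is no absolute constant $c>0$ such that for every integer $n\ge0$ and every choice of real coefficients $\alpha_I$ (indexed by $I\in\mathcal D$ with $|I|\ge2^{-n}$) one has $$\bigg\|\sum_{I\in\mathcal D:\,|I|\ge2^{-n}}\alpha_I h_I\bigg\|_\infty\ \ge\ c\sum_{I\in\mathcal D:\,|I|\ge2^{-n}}|\alpha_I|\cdot|I|.$$
   Context: $\mathcal D$ denotes the set of dyadic intervals in $[0,1)$, i.e. intervals $[m2^{-k},(m+1)2^{-k})$ with $k\in\{0,1,2,\dots\}$ and $m\in\{0,1,\dots,2^k-1\}$; $|I|$ is the length of $I$. For $I\in\mathcal D$, the ($L^\infty$-normalized) Haar function is $h_I=-\mathbf 1_{I_{left}}+\mathbf 1_{I_{right}}$, where $I_{left},I_{right}$ are the left and right (half-open) halves of $I$; so $h_I=0$ outside $I$. $\|\cdot\|_\infty$ is the supremum norm on $[0,1)$. The symbol $\gtrsim$ means "greater than or equal to a positive constant multiple of", with an absolute constant independent of $n$ and of the coefficients. *)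

theory Defs
  imports "HOL-Analysis.Analysis"
begin

definition dyadic_intervals :: "real set set" where
  "dyadic_intervals = {{real m / 2 ^ k ..< (real m + 1) / 2 ^ k} | m k :: nat. m < 2 ^ k}"

abbreviation len :: "real set \<Rightarrow> real" where
  "len I \<equiv> measure lborel I"

definition left_half :: "real set \<Rightarrow> real set" where
  "left_half I = {Inf I ..< (Inf I + Sup I) / 2}"

definition right_half :: "real set \<Rightarrow> real set" where
  "right_half I = {(Inf I + Sup I) / 2 ..< Sup I}"

definition haar :: "real set \<Rightarrow> real \<Rightarrow> real" where
  "haar I x = - indicator (left_half I) x + indicator (right_half I) x"

text \<open>The real-valued supremum is used below for step functions only, which are bounded
  (lemma \<open>bdd_above_haar_sum\<close>); for unbounded functions its value is unspecified.\<close>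

definition sup_norm :: "(real \<Rightarrow> real) \<Rightarrow> real" where
  "sup_norm f = (SUP x\<in>{0..<1}. \<bar>f x\<bar>)"

definition dyadic_upto :: "nat \<Rightarrow> real set set" where
  "dyadic_upto n = {I \<in> dyadic_intervals. len I \<ge> 1 / 2 ^ n}"

lemma len_dyadic: "len {real m / 2 ^ k ..< (real m + 1) / 2 ^ k} = 1 / 2 ^ k"
  by (simp add: divide_right_mono diff_divide_distrib[symmetric])

lemma haar_dyadic:
  "haar {real m / 2 ^ k ..< (real m + 1) / 2 ^ k} x =
     - indicator {real m / 2 ^ k ..< (real m + 1 / 2) / 2 ^ k} x
     + indicator {(real m + 1 / 2) / 2 ^ k ..< (real m + 1) / 2 ^ k} x"
proof -
  have "real m / 2 ^ k < (real m + 1) / 2 ^ k"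
    by (simp add: divide_strict_right_mono)
  moreover have "(real m / 2 ^ k + (real m + 1) / 2 ^ k) / 2 = (real m + 1 / 2) / 2 ^ k"
    by (simp add: field_simps)
  ultimately show ?thesis
    by (simp only: haar_def left_half_def right_half_def cInf_atLeastLessThan cSup_atLeastLessThan)
qed

text \<open>Finiteness ensures that sums over \<open>dyadic_upto n\<close> are not zero by convention.\<close>

lemma finite_dyadic_upto: "finite (dyadic_upto n)"
proof (rule finite_subset)
  let ?F = "\<lambda>(k, m). {real m / 2 ^ k ..< (real m + 1) / 2 ^ k}"
  show "dyadic_upto n \<subseteq> ?F ` (SIGMA k:{..n}. {..<2 ^ k})"
  proof
    fix I assume "I \<in> dyadic_upto n"
    then obtain m k :: nat where I: "I = {real m / 2 ^ k ..< (real m + 1) / 2 ^ k}"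
      and m: "m < 2 ^ k" and l: "len I \<ge> 1 / 2 ^ n"
      unfolding dyadic_upto_def dyadic_intervals_def by blast
    have "(1::real) / 2 ^ n \<le> 1 / 2 ^ k"
      using l unfolding I len_dyadic .
    then have "k \<le> n" by (simp add: field_simps)
    with m I show "I \<in> ?F ` (SIGMA k:{..n}. {..<2 ^ k})"
      by (intro image_eqI[of _ _ "(k, m)"]) auto
  qed
  show "finite (?F ` (SIGMA k:{..n}. {..<2 ^ k}))" by auto
qed

lemma bdd_above_haar_sum:
  "bdd_above ((\<lambda>x. \<bar>\<Sum>I\<in>dyadic_upto n. \<alpha> I * haar I x\<bar>) ` {0..<1})"
proof (rule bdd_aboveI2)
  fix x :: real
  have "\<bar>haar I x\<bar> \<le> 1" for I
    by (auto simp: haar_def left_half_def right_half_def indicator_def)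
  then show "\<bar>\<Sum>I\<in>dyadic_upto n. \<alpha> I * haar I x\<bar> \<le> (\<Sum>I\<in>dyadic_upto n. \<bar>\<alpha> I\<bar>)"
    by (intro order_trans[OF sum_abs] sum_mono) (auto simp: abs_mult intro: mult_left_le)
qed

end

(* The partial sums of a Haar series form a dyadic martingale S_0, S_1, ..., and the right-hand
   side is the sum of the L^1 norms of its increments.  The martingale that starts at 0 and moves
   by +e(1 - S^2) or -e(1 - S^2), with e <= 1/2, never leaves [-1, 1].  Its quadratic variation
   grows by at most e^2 per step, so the mean of 1 - S_k^2 is at least 1 - k e^2, and the mean
   increment stays above e/2 during about 1/(2 e^2) steps: the right-hand side is of order 1/e. *)
theory Submission
  imports Defs
begin

definition dyadic :: "nat \<times> nat \<Rightarrow> real set" where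
  "dyadic = (\<lambda>(k, m). {real m / 2 ^ k ..< (real m + 1) / 2 ^ k})"

lemma len_dyadic_pair: "len (dyadic (k, m)) = 1 / 2 ^ k"
  by (simp only: dyadic_def prod.case len_dyadic)

text \<open>The length recovers \<open>k\<close>, and then the left endpoint recovers
  \<open>m\<close>. This lets coefficients be prescribed through index pairs.\<close>

lemma inj_dyadic: "inj dyadic"
proof (rule injI, clarify)
  fix k m k' m' assume eq: "dyadic (k, m) = dyadic (k', m')"
  have "(1::real) / 2 ^ k = 1 / 2 ^ k'"
    using eq by (metis len_dyadic_pair)
  then have k: "k = k'" by simp
  have inf: "Inf (dyadic (i, j)) = real j / 2 ^ i" for i j
    unfolding dyadic_def prod.case
    by (rule cInf_atLeastLessThan) (simp add: divide_strict_right_mono)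
  have "real m / 2 ^ k = real m' / 2 ^ k'"
    using eq by (metis inf)
  with k show "k = k' \<and> m = m'" by simp
qed

lemma dyadic_upto_eq: "dyadic_upto n = dyadic ` (SIGMA k:{..n}. {..<2 ^ k})"
proof -
  have le: "1 / 2 ^ n \<le> len (dyadic (k, m)) \<longleftrightarrow> k \<le> n" for k m
    unfolding len_dyadic_pair by (simp add: field_simps)
  have dy: "dyadic_intervals = {dyadic (k, m) | m k. m < 2 ^ k}"
    unfolding dyadic_intervals_def dyadic_def by simp
  show ?thesis
  proof (rule subset_antisym; rule subsetI)
    fix I assume I: "I \<in> dyadic_upto n"
    then obtain k m where km: "I = dyadic (k, m)" "m < 2 ^ k"
      unfolding dyadic_upto_def dy by blast
    with I have "k \<le> n" unfolding dyadic_upto_def using le by auto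
    with km show "I \<in> dyadic ` (SIGMA k:{..n}. {..<2 ^ k})" by auto
  next
    fix I assume "I \<in> dyadic ` (SIGMA k:{..n}. {..<2 ^ k})"
    then obtain k m where km: "I = dyadic (k, m)" "k \<le> n" "m < 2 ^ k" by auto
    then have "I \<in> dyadic_intervals" unfolding dy by blast
    with km show "I \<in> dyadic_upto n" unfolding dyadic_upto_def using le by auto
  qed
qed

lemma sum_dyadic_upto:
  fixes f :: "real set \<Rightarrow> real"
  shows "(\<Sum>I\<in>dyadic_upto n. f I) = (\<Sum>k\<le>n. \<Sum>m<2 ^ k. f (dyadic (k, m)))"
proof -
  have "(\<Sum>I\<in>dyadic_upto n. f I) = (\<Sum>p\<in>(SIGMA k:{..n}. {..<2 ^ k}). f (dyadic p))"
    unfolding dyadic_upto_eq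
    by (simp add: sum.reindex inj_on_subset[OF inj_dyadic])
  also have "\<dots> = (\<Sum>k\<le>n. \<Sum>m<2 ^ k. f (dyadic (k, m)))"
    by (simp add: sum.Sigma)
  finally show ?thesis .
qed

text \<open>For x in [0,1) this is the position of the level-\<open>k\<close> interval containing x.
  For k > 0 its parity is the k-th binary digit of x.\<close>

definition dyadic_index :: "real \<Rightarrow> nat \<Rightarrow> nat" where
  "dyadic_index x k = nat \<lfloor>2 ^ k * x\<rfloor>"

lemma dyadic_index_bounds:
  assumes "0 \<le> x"
  shows "real (dyadic_index x k) \<le> 2 ^ k * x" "2 ^ k * x < real (dyadic_index x k) + 1"
  using assms by (simp_all add: dyadic_index_def)

lemma dyadic_index_unique:
  assumes "real m \<le> 2 ^ k * x" "2 ^ k * x < real m + 1"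
  shows "dyadic_index x k = m"
  unfolding dyadic_index_def using assms by linarith

lemma dyadic_index_less:
  assumes "0 \<le> x" "x < 1"
  shows "dyadic_index x k < 2 ^ k"
proof -
  have "real (dyadic_index x k) \<le> 2 ^ k * x"
    using assms by (simp add: dyadic_index_bounds)
  also have "\<dots> < 2 ^ k" using assms by simp
  finally show ?thesis by (simp flip: of_nat_power_eq_of_nat_cancel_iff)
qed

text \<open>Dropping the last binary digit passes to the parent interval, which matches the
  \<open>m div 2\<close> in the recursion of \<open>walk\<close>.\<close>

lemma dyadic_index_Suc_div_2:
  assumes "0 \<le> x"
  shows "dyadic_index x (Suc k) div 2 = dyadic_index x k"
proof (rule dyadic_index_unique[symmetric])
  let ?m = "dyadic_index x (Suc k)"
  have b: "real ?m \<le> 2 * (2 ^ k * x)" "2 * (2 ^ k * x) < real ?m + 1"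
    using dyadic_index_bounds[OF assms, of "Suc k"] by (simp_all add: mult.assoc)
  have "2 * (?m div 2) \<le> ?m" "?m \<le> 2 * (?m div 2) + 1" by linarith+
  then have "2 * real (?m div 2) \<le> real ?m" "real ?m \<le> 2 * real (?m div 2) + 1" by linarith+
  with b show "real (?m div 2) \<le> 2 ^ k * x" "2 ^ k * x < real (?m div 2) + 1" by linarith+
qed

lemma haar_dyadic_pair:
  assumes "0 \<le> x"
  shows "haar (dyadic (k, m)) x =
    (if m = dyadic_index x k then if even (dyadic_index x (Suc k)) then -1 else 1 else 0)"
proof -
  let ?y = "2 ^ k * x" and ?j = "dyadic_index x (Suc k)"
  \<comment> \<open>Scaling by \<open>2 ^ k\<close> reduces membership in the halves to comparing
    \<open>?y\<close> with m, m + 1/2 and m + 1.\<close>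
  have h: "haar (dyadic (k, m)) x =
     - indicator {real m ..< real m + 1 / 2} ?y + indicator {real m + 1 / 2 ..< real m + 1} ?y"
    unfolding dyadic_def prod.case haar_dyadic
    by (simp add: indicator_def field_simps)
  have b: "real ?j \<le> 2 * ?y" "2 * ?y < real ?j + 1"
    using dyadic_index_bounds[OF assms, of "Suc k"] by (simp_all add: mult.assoc)
  note d = dyadic_index_Suc_div_2[OF assms, of k]
  show ?thesis
  proof (cases "m = dyadic_index x k")
    case True
    then consider "?j = 2 * m" | "?j = 2 * m + 1" using d by linarith
    then show ?thesis
      using b True unfolding h by cases (auto simp: indicator_def)
  next
    case False
    then have "\<not> (real m \<le> ?y \<and> ?y < real m + 1)"
      using dyadic_index_unique by blast
    then show ?thesis
      using False unfolding h by (auto simp: indicator_def)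
  qed
qed

text \<open>Intervals of one level are disjoint, so one term survives, signed by the next binary
  digit of x: a martingale increment.\<close>

lemma sum_haar_level:
  assumes "0 \<le> x" "x < 1"
  shows "(\<Sum>m<2 ^ k. a m * haar (dyadic (k, m)) x) =
    (if even (dyadic_index x (Suc k)) then -1 else 1) * a (dyadic_index x k)"
  using dyadic_index_less[OF assms, of k]
  by (simp add: haar_dyadic_pair[OF assms(1)] if_distrib cong: if_cong)

(* walk e k m is the value at time k, on the m-th dyadic interval of length 2^-k. *)
fun walk :: "real \<Rightarrow> nat \<Rightarrow> nat \<Rightarrow> real" where
  "walk e 0 m = 0"
| "walk e (Suc k) m = walk e k (m div 2) +
     (if even m then -1 else 1) * (e * (1 - (walk e k (m div 2))\<^sup>2))"

lemma abs_walk_le_1: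
  assumes "0 \<le> e" "e \<le> 1 / 2"
  shows "\<bar>walk e k m\<bar> \<le> 1"
proof (induction k arbitrary: m)
  case (Suc k)
  define s where "s = walk e k (m div 2)"
  have s: "-1 \<le> s" "s \<le> 1" using Suc[of "m div 2"] by (auto simp: s_def)
  \<comment> \<open>The first two products are 1 - (s + d) and 1 + (s - d) with d = e(1 - s^2), the
    third is d itself. Together they keep both s + d and s - d in [-1, 1].\<close>
  have "0 \<le> (1 - s) * (1 - e * (1 + s))" "0 \<le> (1 + s) * (1 - e * (1 - s))"
    "0 \<le> e * ((1 - s) * (1 + s))"
    using s assms mult_mono[of e "1 / 2" "1 + s" 2] mult_mono[of e "1 / 2" "1 - s" 2]
    by (auto intro!: mult_nonneg_nonneg)
  then show ?case
    using s by (auto simp flip: s_def simp: abs_le_iff power2_eq_square algebra_simps)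
qed simp

lemma sum_lessThan_double:
  fixes g :: "nat \<Rightarrow> 'a::comm_monoid_add"
  shows "(\<Sum>m<2 * n. g m) = (\<Sum>m<n. g (2 * m) + g (2 * m + 1))"
  by (induction n) (simp_all add: ac_simps)

text \<open>Averaging over the two children s + d and s - d cancels the cross terms, so each step
  lowers the mean of 1 - s^2 by d^2, which is at most e^2.\<close>

lemma mean_walk_defect:
  assumes "0 \<le> e" "e \<le> 1 / 2"
  shows "(\<Sum>m<2 ^ k. 1 - (walk e k m)\<^sup>2) \<ge> 2 ^ k * (1 - k * e\<^sup>2)"
proof (induction k)
  case (Suc k)
  have step: "2 * (1 - (walk e k m)\<^sup>2) - 2 * e\<^sup>2 \<le>
    (1 - (walk e (Suc k) (2 * m))\<^sup>2) + (1 - (walk e (Suc k) (2 * m + 1))\<^sup>2)" for m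
  proof -
    define s where "s = walk e k m"
    have "s\<^sup>2 \<le> 1" using abs_walk_le_1[OF assms, of k m] by (simp add: s_def abs_square_le_1)
    then have "e\<^sup>2 * (1 - s\<^sup>2)\<^sup>2 \<le> e\<^sup>2"
      by (intro mult_left_le) (auto simp: abs_square_le_1)
    moreover have "(1 - (s + - 1 * (e * (1 - s\<^sup>2)))\<^sup>2) + (1 - (s + e * (1 - s\<^sup>2))\<^sup>2) =
      2 * (1 - s\<^sup>2) - 2 * (e\<^sup>2 * (1 - s\<^sup>2)\<^sup>2)"
      by (simp add: power2_eq_square algebra_simps)
    ultimately show ?thesis by (simp add: s_def)
  qed
  have "2 ^ Suc k * (1 - Suc k * e\<^sup>2) = 2 * (2 ^ k * (1 - k * e\<^sup>2)) - 2 ^ k * (2 * e\<^sup>2)"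
    by (simp add: algebra_simps)
  also have "\<dots> \<le> 2 * (\<Sum>m<2 ^ k. 1 - (walk e k m)\<^sup>2) - 2 ^ k * (2 * e\<^sup>2)"
    using Suc by simp
  also have "\<dots> = (\<Sum>m<2 ^ k. 2 * (1 - (walk e k m)\<^sup>2) - 2 * e\<^sup>2)"
    by (simp add: sum_distrib_left sum_subtractf)
  also have "\<dots> \<le> (\<Sum>m<2 ^ k. (1 - (walk e (Suc k) (2 * m))\<^sup>2) +
      (1 - (walk e (Suc k) (2 * m + 1))\<^sup>2))"
    by (intro sum_mono step)
  also have "\<dots> = (\<Sum>m<2 ^ Suc k. 1 - (walk e (Suc k) m)\<^sup>2)"
    unfolding power_Suc by (rule sum_lessThan_double[symmetric])
  finally show ?case .
qed simp

text \<open>Coefficients are indexed by sets, so \<open>inv dyadic\<close> recovers the pair; only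
  values on the range of \<open>dyadic\<close> enter the sums.\<close>

definition walk_coeff :: "real \<Rightarrow> real set \<Rightarrow> real" where
  "walk_coeff e I = (case inv dyadic I of (k, m) \<Rightarrow> e * (1 - (walk e k m)\<^sup>2))"

lemma walk_coeff_dyadic: "walk_coeff e (dyadic (k, m)) = e * (1 - (walk e k m)\<^sup>2)"
  by (simp add: walk_coeff_def inv_f_f[OF inj_dyadic])

text \<open>Level \<open>k\<close> contributes exactly the move from time k to k + 1. Levels 0 to n
  make n + 1 moves, hence \<open>Suc n\<close>.\<close>

lemma haar_sum_walk_coeff:
  assumes "0 \<le> x" "x < 1"
  shows "(\<Sum>I\<in>dyadic_upto n. walk_coeff e I * haar I x) =
    walk e (Suc n) (dyadic_index x (Suc n))"
proof -
  have "(\<Sum>k<N. \<Sum>m<2 ^ k. walk_coeff e (dyadic (k, m)) * haar (dyadic (k, m)) x) =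
    walk e N (dyadic_index x N)" for N
    by (induction N)
      (simp_all add: sum_haar_level[OF assms] walk_coeff_dyadic dyadic_index_Suc_div_2 assms)
  then show ?thesis
    by (simp only: sum_dyadic_upto flip: lessThan_Suc_atMost)
qed

lemma sup_norm_walk_coeff:
  assumes "0 \<le> e" "e \<le> 1 / 2"
  shows "sup_norm (\<lambda>x. \<Sum>I\<in>dyadic_upto n. walk_coeff e I * haar I x) \<le> 1"
  unfolding sup_norm_def
  \<comment> \<open>\<open>walk.simps\<close> is withheld so that \<open>walk e (Suc n)\<close>
    stays folded and the uniform bound applies.\<close>
  by (rule cSUP_least) (auto simp: haar_sum_walk_coeff simp del: walk.simps intro: abs_walk_le_1[OF assms])

lemma sum_abs_walk_coeff:
  assumes "0 \<le> e" "e \<le> 1 / 2" "real n * e\<^sup>2 \<le> 1 / 2"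
  shows "(\<Sum>I\<in>dyadic_upto n. \<bar>walk_coeff e I\<bar> * len I) \<ge> real n * e / 2"
proof -
  have level: "e / 2 \<le> (\<Sum>m<2 ^ k. \<bar>walk_coeff e (dyadic (k, m))\<bar> * len (dyadic (k, m)))"
    if "k \<le> n" for k
  proof -
    have "real k * e\<^sup>2 \<le> real n * e\<^sup>2" using that by (intro mult_right_mono) auto
    then have "1 / 2 \<le> 1 - real k * e\<^sup>2" using assms by linarith
    then have "(2::real) ^ k * (1 / 2) \<le> 2 ^ k * (1 - real k * e\<^sup>2)"
      by (intro mult_left_mono) auto
    also have "\<dots> \<le> (\<Sum>m<2 ^ k. 1 - (walk e k m)\<^sup>2)"
      by (rule mean_walk_defect[OF assms(1,2)])
    \<comment> \<open>The factor \<open>e\<close> comes from the coefficients and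
      \<open>1 / 2 ^ k\<close> from the interval length.\<close>
    finally have "e / 2 ^ k * (2 ^ k * (1 / 2)) \<le> e / 2 ^ k * (\<Sum>m<2 ^ k. 1 - (walk e k m)\<^sup>2)"
      using assms by (intro mult_left_mono) auto
    also have "\<dots> = (\<Sum>m<2 ^ k. e * (1 - (walk e k m)\<^sup>2) * (1 / 2 ^ k))"
      by (simp add: sum_distrib_left)
    also have "\<dots> \<le> (\<Sum>m<2 ^ k. \<bar>walk_coeff e (dyadic (k, m))\<bar> * len (dyadic (k, m)))"
      unfolding walk_coeff_dyadic len_dyadic_pair
      by (intro sum_mono mult_right_mono) auto
    finally show ?thesis by simp
  qed
  \<comment> \<open>There are n + 1 levels, each worth at least e/2; one is given away.\<close>
  have "real n * e / 2 \<le> (\<Sum>k\<le>n. e / 2)"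
    using assms by (simp add: field_simps)
  also have "\<dots> \<le> (\<Sum>I\<in>dyadic_upto n. \<bar>walk_coeff e I\<bar> * len I)"
    unfolding sum_dyadic_upto by (intro sum_mono level) simp
  finally show ?thesis .
qed

theorem mainTheorem8:
  shows "\<not> (\<exists>c::real. c > 0 \<and>
    (\<forall>(n::nat) (\<alpha> :: real set \<Rightarrow> real).
       sup_norm (\<lambda>x. \<Sum>I\<in>dyadic_upto n. \<alpha> I * haar I x)
         \<ge> c * (\<Sum>I\<in>dyadic_upto n. \<bar>\<alpha> I\<bar> * len I)))"
proof
  assume "\<exists>c::real. c > 0 \<and>
    (\<forall>(n::nat) (\<alpha> :: real set \<Rightarrow> real).
       sup_norm (\<lambda>x. \<Sum>I\<in>dyadic_upto n. \<alpha> I * haar I x)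
         \<ge> c * (\<Sum>I\<in>dyadic_upto n. \<bar>\<alpha> I\<bar> * len I))"
  then obtain c :: real where c: "c > 0" and bound:
    "\<And>n \<alpha>. c * (\<Sum>I\<in>dyadic_upto n. \<bar>\<alpha> I\<bar> * len I) \<le>
      sup_norm (\<lambda>x. \<Sum>I\<in>dyadic_upto n. \<alpha> I * haar I x)" by blast
  obtain N :: nat where N: "2 / c < real N" using reals_Archimedean2 by blast
  then have "0 < real N" using c by (meson divide_pos_pos less_trans zero_less_numeral)
  \<comment> \<open>This makes n e^2 exactly 1/2, the longest run that
    \<open>sum_abs_walk_coeff\<close> allows, and its lower bound N/2, which exceeds 1/c by the
    choice of \<open>N\<close>.\<close>
  define e n where "e = 1 / (2 * real N)" and "n = 2 * N\<^sup>2"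
  have e: "0 \<le> e" "e \<le> 1 / 2" "real n * e\<^sup>2 \<le> 1 / 2" and ne: "real n * e / 2 = real N / 2"
    using \<open>0 < real N\<close> by (auto simp: e_def n_def power2_eq_square field_simps)
  have "1 < c * (real N / 2)" using N c by (simp add: field_simps)
  also have "\<dots> \<le> c * (\<Sum>I\<in>dyadic_upto n. \<bar>walk_coeff e I\<bar> * len I)"
    using sum_abs_walk_coeff[OF e] c unfolding ne by (intro mult_left_mono) auto
  also have "\<dots> \<le> 1"
    using bound sup_norm_walk_coeff[OF e(1,2)] by (rule order_trans)
  finally show False by simp
qed

end
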